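(* Let $\gamma\ge1$. The entropy pairs $(Q_1,Q_2)$ of the potential flow system, as functions of $(\rho,\theta)$, are given by the Loewner–Morawetz relation $$Q_1=\rho qH_\mu\cos\theta-qH_\theta\sin\theta,\qquad Q_2=\rho qH_\mu\sin\theta+qH_\theta\cos\theta,$$ where the generators $H=H(\mu,\theta)$ are all solutions of the generalized Tricomi equation $$H_{\mu\mu}+\frac1{\rho^2}(1-M^2)H_{\theta\theta}=0 .$$ That is, smooth functions $(Q_1,Q_2)$ form an entropy pair (as defined in the context) if and only if they have this form for some smooth solution $H$ of the generalized Tricomi equation.
   Context: Gas law. For $\gamma>1$: $\rho(q)=(1-\frac{\gamma-1}{2}q^2)^{1/(\gamma-1)}$, $c^2=1-\frac{\gamma-1}{2}q^2$, $0<q<q_{cav}=\sqrt{2/(\gamma-1)}$. For $\gamma=1$: $\rho(q)=e^{-q^2/2}$, $c=1$, $0<q<q_{cav}=\infty$. Thus $\rho\in(0,1)$, $q$ and $c$ are functions of $\rho$, and $\theta\in\mathbb R$. $M=q/c$ is the Mach number and $\mu=\mu(\rho)$ is defined (up to an additive constant) by $\mu'(\rho)=c^2/q^2$; thus functions of $(\mu,\theta)$ and of $(\rho,\theta)$ are identified. The potential flow system is $v_x-u_y=0$, $(\rho u)_x+(\rho v)_y=0$ with $(u,v)=(q\cos\theta,q\sin\theta)$. A pair $(Q_1,Q_2)$ of smooth functions of $(\rho,\theta)$ is an entropy pair if there is a smooth function $V(\rho,\theta)$ such that $$\frac{\partial Q_1}{\partial\rho}=\frac{c^2}{\rho q}\sin\theta\,V_\theta-q\cos\theta\,V_\rho,\qquad\frac{\partial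 Q_1}{\partial\theta}=-q\cos\theta\,V_\theta-\frac{\rho q^3\sin\theta}{c^2-q^2}V_\rho,$$ $$\frac{\partial Q_2}{\partial\rho}=-\frac{c^2}{\rho q}\cos\theta\,V_\theta-q\sin\theta\,V_\rho,\qquad\frac{\partial Q_2}{\partial\theta}=-q\sin\theta\,V_\theta+\frac{\rho q^3\cos\theta}{c^2-q^2}V_\rho,$$ where $V_\rho/(c^2-q^2)$ is understood to extend smoothly across $q=c$. (The functions $H$ and $V$ are related by $\rho H_{\mu\theta}-H_\theta=-V_\theta$ and $H_\mu+\frac1\rho H_{\theta\theta}=\frac{q^2}{c^2-q^2}V_\rho$.) *)

theory Defs
  imports "HOL-Analysis.Analysis"
begin

section \<open>Smooth functions and partial derivatives\<close>

fun C_k_on :: "nat \<Rightarrow> 'a::real_normed_vector set \<Rightarrow> ('a \<Rightarrow> 'b::real_normed_vector) \<Rightarrow> bool" where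
  "C_k_on 0 S f \<longleftrightarrow> continuous_on S f"
| "C_k_on (Suc k) S f \<longleftrightarrow>
     (\<forall>x\<in>S. f differentiable (at x)) \<and> (\<forall>v. C_k_on k S (\<lambda>x. frechet_derivative f (at x) v))"

text \<open>The derivatives are full derivatives \<open>at x\<close>, so \<open>smooth_on\<close> is meant for open sets,
  where it depends only on the values of the function on the set.\<close>

definition smooth_on :: "'a::real_normed_vector set \<Rightarrow> ('a \<Rightarrow> 'b::real_normed_vector) \<Rightarrow> bool" where
  "smooth_on S f \<longleftrightarrow> (\<forall>k. C_k_on k S f)"

definition pd1 :: "(real \<times> real \<Rightarrow> real) \<Rightarrow> real \<times> real \<Rightarrow> real" where
  "pd1 F p = deriv (\<lambda>t. F (t, snd p)) (fst p)"

definition pd2 :: "(real \<times> real \<Rightarrow> real) \<Rightarrow> real \<times> real \<Rightarrow> real" where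
  "pd2 F p = deriv (\<lambda>t. F (fst p, t)) (snd p)"


section \<open>The gas law\<close>

text \<open>Throughout, \<open>g\<close> is the adiabatic exponent, \<open>g \<ge> 1\<close>.\<close>

definition density :: "real \<Rightarrow> real \<Rightarrow> real" where
  "density g q = (if g = 1 then exp (- q\<^sup>2 / 2)
                  else (1 - (g - 1) / 2 * q\<^sup>2) powr (1 / (g - 1)))"

definition sound_speed :: "real \<Rightarrow> real \<Rightarrow> real" where
  "sound_speed g q = (if g = 1 then 1 else sqrt (1 - (g - 1) / 2 * q\<^sup>2))"

text \<open>The open interval from \<open>0\<close> to the cavitation speed, which is infinite for \<open>g = 1\<close>.\<close>

definition speeds :: "real \<Rightarrow> real set" where
  "speeds g = (if g = 1 then {0<..} else {0<..<sqrt (2 / (g - 1))})"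

text \<open>The speed, the speed of sound and the Mach number as functions of the density
  \<open>r\<close>, for \<open>r\<close> between \<open>0\<close> and \<open>1\<close>; see \<open>bij_betw_density\<close> below.\<close>

definition q_of :: "real \<Rightarrow> real \<Rightarrow> real" where
  "q_of g = the_inv_into (speeds g) (density g)"

definition c_of :: "real \<Rightarrow> real \<Rightarrow> real" where
  "c_of g r = sound_speed g (q_of g r)"

definition mach :: "real \<Rightarrow> real \<Rightarrow> real" where
  "mach g r = q_of g r / c_of g r"

text \<open>The variable \<open>\<mu>\<close> is only determined up to an additive constant, so it is
  specified by a predicate; see \<open>ex_mu_function\<close> below.\<close>

definition mu_function :: "real \<Rightarrow> (real \<Rightarrow> real) \<Rightarrow> bool" where
  "mu_function g \<mu> \<longleftrightarrow>
     (\<forall>r\<in>{0<..<1}. (\<mu> has_real_derivative (c_of g r)\<^sup>2 / (q_of g r)\<^sup>2) (at r))"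


section \<open>Entropy pairs and the generalized Tricomi equation\<close>

definition rho_theta_domain :: "(real \<times> real) set" where
  "rho_theta_domain = {0<..<1} \<times> UNIV"

definition mu_theta_domain :: "(real \<Rightarrow> real) \<Rightarrow> (real \<times> real) set" where
  "mu_theta_domain \<mu> = \<mu> ` {0<..<1} \<times> UNIV"

text \<open>The function \<open>W\<close> is the smooth extension of \<open>V\<^sub>\<rho> / (c\<^sup>2 - q\<^sup>2)\<close> across the sonic line
  \<open>q = c\<close>.\<close>

definition entropy_pair ::
    "real \<Rightarrow> (real \<times> real \<Rightarrow> real) \<Rightarrow> (real \<times> real \<Rightarrow> real) \<Rightarrow> bool" where
  "entropy_pair g Q1 Q2 \<longleftrightarrow>
     smooth_on rho_theta_domain Q1 \<and> smooth_on rho_theta_domain Q2 \<and>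
     (\<exists>V W. smooth_on rho_theta_domain V \<and> smooth_on rho_theta_domain W \<and>
        (\<forall>r\<in>{0<..<1}. \<forall>\<theta>. let q = q_of g r; c = c_of g r in
           (q \<noteq> c \<longrightarrow> W (r, \<theta>) = pd1 V (r, \<theta>) / (c\<^sup>2 - q\<^sup>2)) \<and>
           pd1 Q1 (r, \<theta>) =
             c\<^sup>2 / (r * q) * sin \<theta> * pd2 V (r, \<theta>) - q * cos \<theta> * pd1 V (r, \<theta>) \<and>
           pd2 Q1 (r, \<theta>) =
             - q * cos \<theta> * pd2 V (r, \<theta>) - r * q ^ 3 * sin \<theta> * W (r, \<theta>) \<and>
           pd1 Q2 (r, \<theta>) =
             - (c\<^sup>2 / (r * q)) * cos \<theta> * pd2 V (r, \<theta>) - q * sin \<theta> * pd1 V (r, \<theta>) \<and>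
           pd2 Q2 (r, \<theta>) =
             - q * sin \<theta> * pd2 V (r, \<theta>) + r * q ^ 3 * cos \<theta> * W (r, \<theta>)))"

text \<open>A generator \<open>H\<close> is a function of \<open>(\<mu>, \<theta>)\<close>, so \<open>pd1\<close> is its derivative with respect to
  \<open>\<mu>\<close>; the points of its domain are parametrized by \<open>(\<rho>, \<theta>)\<close>.\<close>

definition tricomi_solution ::
    "real \<Rightarrow> (real \<Rightarrow> real) \<Rightarrow> (real \<times> real \<Rightarrow> real) \<Rightarrow> bool" where
  "tricomi_solution g \<mu> H \<longleftrightarrow>
     smooth_on (mu_theta_domain \<mu>) H \<and>
     (\<forall>r\<in>{0<..<1}. \<forall>\<theta>.
        pd1 (pd1 H) (\<mu> r, \<theta>) + 1 / r\<^sup>2 * (1 - (mach g r)\<^sup>2) * pd2 (pd2 H) (\<mu> r, \<theta>) = 0)"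

definition loewner_morawetz ::
    "real \<Rightarrow> (real \<Rightarrow> real) \<Rightarrow> (real \<times> real \<Rightarrow> real) \<Rightarrow>
     (real \<times> real \<Rightarrow> real) \<Rightarrow> (real \<times> real \<Rightarrow> real) \<Rightarrow> bool" where
  "loewner_morawetz g \<mu> H Q1 Q2 \<longleftrightarrow>
     (\<forall>r\<in>{0<..<1}. \<forall>\<theta>. let q = q_of g r in
        Q1 (r, \<theta>) = r * q * pd1 H (\<mu> r, \<theta>) * cos \<theta> - q * pd2 H (\<mu> r, \<theta>) * sin \<theta> \<and>
        Q2 (r, \<theta>) = r * q * pd1 H (\<mu> r, \<theta>) * sin \<theta> + q * pd2 H (\<mu> r, \<theta>) * cos \<theta>)"


section \<open>Well-definedness of the speed and of \<open>\<mu>\<close>\<close>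

definition speed_formula :: "real \<Rightarrow> real \<Rightarrow> real" where
  "speed_formula g r = (if g = 1 then sqrt (- 2 * ln r)
                        else sqrt (2 / (g - 1) * (1 - r powr (g - 1))))"

lemma bij_betw_density_formula:
  assumes "g \<ge> 1"
  shows "bij_betw (density g) (speeds g) {0<..<1}"
    and "\<And>r. r \<in> {0<..<1} \<Longrightarrow> speed_formula g r \<in> speeds g \<and> density g (speed_formula g r) = r"
proof -
  have D: "density g q \<in> {0<..<1} \<and> speed_formula g (density g q) = q" if "q \<in> speeds g" for q
  proof (cases "g = 1")
    case True
    with that show ?thesis by (simp add: density_def speed_formula_def speeds_def)
  next
    case False
    with assms that have g: "g > 1" and q: "0 < q" "q < sqrt (2 / (g - 1))"
      by (auto simp: speeds_def)
    have "q\<^sup>2 < (sqrt (2 / (g - 1)))\<^sup>2"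
      by (rule power_strict_mono) (use q in auto)
    with g have "q\<^sup>2 < 2 / (g - 1)" by simp
    with g have x: "(g - 1) / 2 * q\<^sup>2 < 1" "(g - 1) / 2 * q\<^sup>2 > 0"
      using q by (auto simp: field_simps)
    have "(1 - (g - 1) / 2 * q\<^sup>2) powr (1 / (g - 1)) < 1 powr (1 / (g - 1))"
      by (rule powr_less_mono2) (use x g in auto)
    moreover have "((1 - (g - 1) / 2 * q\<^sup>2) powr (1 / (g - 1))) powr (g - 1) = 1 - (g - 1) / 2 * q\<^sup>2"
      using x g by (simp add: powr_powr)
    moreover from this have "speed_formula g (density g q) = sqrt (q\<^sup>2)"
      using g by (simp add: density_def speed_formula_def)
    ultimately show ?thesis
      using g q x by (simp add: density_def)
  qed
  show S: "speed_formula g r \<in> speeds g \<and> density g (speed_formula g r) = r"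
    if r: "r \<in> {0<..<1}" for r
  proof (cases "g = 1")
    case True
    with r show ?thesis by (simp add: density_def speed_formula_def speeds_def)
  next
    case False
    with assms have g: "g > 1" by simp
    have "r powr (g - 1) < 1 powr (g - 1)"
      by (rule powr_less_mono2) (use r g in auto)
    moreover have "r powr (g - 1) > 0"
      using r by simp
    ultimately have x: "2 / (g - 1) * (1 - r powr (g - 1)) > 0"
        "2 / (g - 1) * (1 - r powr (g - 1)) < 2 / (g - 1)"
      using g by (auto simp: field_simps)
    have "1 - (g - 1) / 2 * (2 / (g - 1) * (1 - r powr (g - 1))) = r powr (g - 1)"
    proof -
      have "(g - 1) / 2 * (2 / (g - 1)) = 1"
        using g by simp
      then show ?thesis
        by (simp only: mult.assoc[symmetric]) simp
    qed
    moreover have "(speed_formula g r)\<^sup>2 = 2 / (g - 1) * (1 - r powr (g - 1))"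
      using g x unfolding speed_formula_def by (simp del: times_divide_eq_left)
    ultimately have "density g (speed_formula g r) = (r powr (g - 1)) powr (1 / (g - 1))"
      using g by (simp only: density_def) simp
    also have "\<dots> = r"
      using g r by (simp add: powr_powr)
    finally show ?thesis
      using g x unfolding speed_formula_def speeds_def by (simp del: times_divide_eq_left)
  qed
  show "bij_betw (density g) (speeds g) {0<..<1}"
    by (rule bij_betw_byWitness[where f' = "speed_formula g"]) (use D S in auto)
qed

lemmas bij_betw_density = bij_betw_density_formula(1)

lemma q_of_eq:
  assumes "g \<ge> 1" "r \<in> {0<..<1}"
  shows "q_of g r = speed_formula g r"
  unfolding q_of_def
  by (rule the_inv_into_f_eq)
    (use assms bij_betw_density_formula[OF assms(1)] in \<open>auto simp: bij_betw_def\<close>)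

lemma ex_mu_function:
  assumes "g \<ge> 1"
  shows "\<exists>\<mu>. mu_function g \<mu>"
proof -
  have cont: "continuous_on {0<..<1} (speed_formula g)"
    unfolding speed_formula_def by (cases "g = 1") (auto intro!: continuous_intros)
  have pos: "speed_formula g r > 0" if "r \<in> {0<..<1}" for r
    using bij_betw_density_formula(2)[OF assms that] by (auto simp: speeds_def split: if_splits)
  have contc: "continuous_on {0<..<1} (\<lambda>r. sound_speed g (speed_formula g r))"
  proof (cases "g = 1")
    case False
    have "continuous_on {0<..<1} (\<lambda>r. sqrt (1 - (g - 1) / 2 * (speed_formula g r)\<^sup>2))"
      by (intro continuous_on_real_sqrt continuous_on_diff continuous_on_mult
          continuous_on_power continuous_on_const cont)
    with False show ?thesis by (simp add: sound_speed_def)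
  qed (simp add: sound_speed_def)
  have contF: "continuous_on {0<..<1} (\<lambda>r. (sound_speed g (speed_formula g r))\<^sup>2 / (speed_formula g r)\<^sup>2)"
  proof (rule continuous_on_divide)
    show "\<forall>r\<in>{0<..<1}. (speed_formula g r)\<^sup>2 \<noteq> 0"
      using pos by fastforce
  qed (intro continuous_on_power cont contc)+
  have "\<exists>F. \<forall>x. ereal 0 < ereal x \<longrightarrow> ereal x < ereal 1 \<longrightarrow>
      (F has_vector_derivative (sound_speed g (speed_formula g x))\<^sup>2 / (speed_formula g x)\<^sup>2) (at x)"
    using contF by (intro einterval_antiderivative) (auto simp: continuous_on_eq_continuous_at)
  then obtain F where "\<forall>x\<in>{0<..<1}.
      (F has_vector_derivative (sound_speed g (speed_formula g x))\<^sup>2 / (speed_formula g x)\<^sup>2) (at x)"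
    by (metis ereal_less(2,3) greaterThanLessThan_iff less_ereal.simps(1) zero_ereal_def one_ereal_def)
  then have "mu_function g F"
    by (simp add: mu_function_def c_of_def q_of_eq[OF assms]
        has_real_derivative_iff_has_vector_derivative)
  then show ?thesis
    by (rule exI[where x = F])
qed

end

theory Submission
  imports Defs
begin

text \<open>
  No integration is needed: the generator and the potential \<open>V\<close> are explicit in terms of each other,
  \<open>V = H - \<rho> H\<^sub>\<mu>\<close> and \<open>H = V + P / q\<close>. Here \<open>P = Q\<^sub>1 cos \<theta> + Q\<^sub>2 sin \<theta>\<close> and
  \<open>N = Q\<^sub>2 cos \<theta> - Q\<^sub>1 sin \<theta>\<close> are the rotated components of the entropy pair, in which the
  Loewner--Morawetz relation reads \<open>P = \<rho> q H\<^sub>\<mu>\<close>, \<open>N = q H\<^sub>\<theta>\<close>, and the entropy pair equations read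
  \<open>P\<^sub>\<rho> = - q V\<^sub>\<rho>\<close>, \<open>P\<^sub>\<theta> = N - q V\<^sub>\<theta>\<close>, \<open>N\<^sub>\<rho> = - c\<^sup>2 / (\<rho> q) V\<^sub>\<theta>\<close>, \<open>N\<^sub>\<theta> = \<rho> q\<^sup>3 W - P\<close>.
  With \<open>q' = - c\<^sup>2 / (\<rho> q)\<close>, the Tricomi equation then becomes \<open>V\<^sub>\<rho> = (c\<^sup>2 - q\<^sup>2) W\<close>. On the sonic line
  this identity holds by continuity, because \<open>c\<^sup>2 - q\<^sup>2\<close> has positive derivative in \<open>\<rho>\<close>.
\<close>

section \<open>Calculus of smooth functions on open sets\<close>

text \<open>Near a point of an open set \<open>f\<close> and \<open>g\<close> coincide, so a
  derivative of \<open>f\<close> there is one of \<open>g\<close>; the induction passes this on to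
  the derivatives in each fixed direction.\<close>

lemma C_k_on_cong:
  assumes "open S" "C_k_on k S f" "\<And>x. x \<in> S \<Longrightarrow> f x = g x"
  shows "C_k_on k S g"
  using assms(2,3)
proof (induction k arbitrary: f g)
  case 0
  then show ?case
    using continuous_on_cong[of S S f g] by simp
next
  case (Suc k)
  have D: "(g has_derivative frechet_derivative f (at x)) (at x)" if x: "x \<in> S" for x
  proof -
    have "(f has_derivative frechet_derivative f (at x)) (at x)"
      using Suc.prems(1) frechet_derivative_works x by auto
    then show ?thesis
      by (rule has_derivative_transform_within_open[OF _ \<open>open S\<close> x Suc.prems(2)])
  qed
  have "C_k_on k S (\<lambda>x. frechet_derivative g (at x) v)" for v
    by (rule Suc.IH[of "\<lambda>x. frechet_derivative f (at x) v"])
      (use Suc.prems in \<open>auto simp: frechet_derivative_at[OF D, symmetric]\<close>)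
  then show ?case
    using D by (auto simp: differentiable_def)
qed

text \<open>Any exhibited derivative \<open>D\<close> may stand in for
  \<open>frechet_derivative\<close>: by uniqueness the two agree on \<open>S\<close>, and by
  \<open>C_k_on_cong\<close> agreement on \<open>S\<close> is enough.\<close>

lemma C_k_on_SucI:
  assumes "open S" and D: "\<And>x. x \<in> S \<Longrightarrow> (f has_derivative D x) (at x)"
    and C: "\<And>v. C_k_on k S (\<lambda>x. D x v)"
  shows "C_k_on (Suc k) S f"
proof -
  have "C_k_on k S (\<lambda>x. frechet_derivative f (at x) v)" for v
    by (rule C_k_on_cong[OF assms(1) C[of v]]) (simp add: frechet_derivative_at[OF D, symmetric])
  then show ?thesis
    using D by (auto simp: differentiable_def)
qed

lemma C_k_on_Suc_imp: "C_k_on (Suc k) S f \<Longrightarrow> C_k_on k S f"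
proof (induction k arbitrary: f)
  case 0
  then show ?case
    by (auto intro!: continuous_at_imp_continuous_on differentiable_imp_continuous_within)
qed (auto simp del: C_k_on.simps simp: C_k_on.simps(2))

lemma C_k_on_differentiable: "C_k_on (Suc k) S f \<Longrightarrow> x \<in> S \<Longrightarrow>
    (f has_derivative frechet_derivative f (at x)) (at x)"
  by (auto simp: frechet_derivative_works)

section \<open>Closure of the smoothness classes under arithmetic\<close>

lemma C_k_on_const: "open S \<Longrightarrow> C_k_on k S (\<lambda>x. c)"
proof (induction k arbitrary: c)
  case (Suc k)
  show ?case
    by (rule C_k_on_SucI[OF \<open>open S\<close> has_derivative_const]) (use Suc in auto)
qed auto

text \<open>The derivative at every point is the map itself, so in each fixed direction it is a
  constant function.\<close>

lemma C_k_on_bounded_linear: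
  assumes "open S" "bounded_linear f"
  shows "C_k_on k S f"
proof (cases k)
  case 0
  then show ?thesis
    using assms by (simp add: linear_continuous_on)
next
  case (Suc n)
  show ?thesis
    unfolding Suc
    by (rule C_k_on_SucI[OF assms(1) bounded_linear_imp_has_derivative[OF assms(2)]])
      (use assms in \<open>auto intro: C_k_on_const\<close>)
qed

lemma C_k_on_add:
  assumes "open S"
  shows "C_k_on k S f \<Longrightarrow> C_k_on k S g \<Longrightarrow> C_k_on k S (\<lambda>x. f x + g x)"
proof (induction k arbitrary: f g)
  case 0
  then show ?case by (auto intro: continuous_on_add)
next
  case (Suc k)
  show ?case
    by (rule C_k_on_SucI[OF assms has_derivative_add[OF
            C_k_on_differentiable[OF Suc.prems(1)] C_k_on_differentiable[OF Suc.prems(2)]]])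
      (use Suc assms in auto)
qed

lemma C_k_on_mult:
  fixes f g :: "'a::real_normed_vector \<Rightarrow> real"
  assumes "open S"
  shows "C_k_on k S f \<Longrightarrow> C_k_on k S g \<Longrightarrow> C_k_on k S (\<lambda>x. f x * g x)"
proof (induction k arbitrary: f g)
  case 0
  then show ?case by (auto intro: continuous_on_mult)
next
  case (Suc k)
  show ?case
  proof (rule C_k_on_SucI[OF assms has_derivative_mult[OF
            C_k_on_differentiable[OF Suc.prems(1)] C_k_on_differentiable[OF Suc.prems(2)]]])
    \<comment> \<open>The product rule leaves undifferentiated factors as well;
      \<open>C_k_on_Suc_imp\<close> lowers these to order \<open>k\<close>.\<close>
    show "C_k_on k S (\<lambda>x. f x * frechet_derivative g (at x) v + frechet_derivative f (at x) v * g x)" for v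
      using Suc.prems C_k_on_Suc_imp[OF Suc.prems(1)] C_k_on_Suc_imp[OF Suc.prems(2)]
      by (intro C_k_on_add[OF assms] Suc.IH) auto
  qed (use assms in auto)
qed

text \<open>The derivative of the reciprocal contains the reciprocal itself, which is already of
  order \<open>k\<close> by the induction hypothesis.\<close>

lemma C_k_on_inverse:
  fixes f :: "'a::real_normed_vector \<Rightarrow> real"
  assumes "open S" and nz: "\<And>x. x \<in> S \<Longrightarrow> f x \<noteq> 0"
  shows "C_k_on k S f \<Longrightarrow> C_k_on k S (\<lambda>x. inverse (f x))"
proof (induction k)
  case 0
  then show ?case using nz by (auto intro: continuous_on_inverse)
next
  case (Suc k)
  have inv: "C_k_on k S (\<lambda>x. inverse (f x))"
    using Suc C_k_on_Suc_imp by blast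
  show ?case
  proof (rule C_k_on_SucI[OF \<open>open S\<close> Deriv.has_derivative_inverse[OF nz C_k_on_differentiable[OF Suc.prems]]])
    fix v
    have "C_k_on k S (\<lambda>x. (-1) * (inverse (f x) * frechet_derivative f (at x) v * inverse (f x)))"
      using inv Suc.prems by (intro C_k_on_mult[OF \<open>open S\<close>] C_k_on_const) (auto simp: \<open>open S\<close>)
    then show "C_k_on k S (\<lambda>x. - (inverse (f x) * frechet_derivative f (at x) v * inverse (f x)))"
      by simp
  qed (use assms in auto)
qed

lemma smooth_on_cong:
  "open S \<Longrightarrow> smooth_on S f \<Longrightarrow> (\<And>x. x \<in> S \<Longrightarrow> f x = g x) \<Longrightarrow> smooth_on S g"
  unfolding smooth_on_def using C_k_on_cong by blast

lemma smooth_on_const: "open S \<Longrightarrow> smooth_on S (\<lambda>x. c)"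
  unfolding smooth_on_def using C_k_on_const by blast

lemma smooth_on_add: "open S \<Longrightarrow> smooth_on S f \<Longrightarrow> smooth_on S g \<Longrightarrow> smooth_on S (\<lambda>x. f x + g x)"
  unfolding smooth_on_def using C_k_on_add by blast

lemma smooth_on_mult:
  fixes f g :: "'a::real_normed_vector \<Rightarrow> real"
  shows "open S \<Longrightarrow> smooth_on S f \<Longrightarrow> smooth_on S g \<Longrightarrow> smooth_on S (\<lambda>x. f x * g x)"
  unfolding smooth_on_def using C_k_on_mult by blast

lemma smooth_on_minus:
  fixes f :: "'a::real_normed_vector \<Rightarrow> real"
  assumes "open S" "smooth_on S f"
  shows "smooth_on S (\<lambda>x. - f x)"
  using smooth_on_mult[OF assms(1) smooth_on_const[OF assms(1), of "-1"] assms(2)] by simp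

lemma smooth_on_diff:
  fixes f g :: "'a::real_normed_vector \<Rightarrow> real"
  assumes "open S" "smooth_on S f" "smooth_on S g"
  shows "smooth_on S (\<lambda>x. f x - g x)"
  using smooth_on_add[OF assms(1,2) smooth_on_minus[OF assms(1,3)]] by simp

lemma smooth_on_inverse:
  fixes f :: "'a::real_normed_vector \<Rightarrow> real"
  shows "open S \<Longrightarrow> smooth_on S f \<Longrightarrow> (\<And>x. x \<in> S \<Longrightarrow> f x \<noteq> 0) \<Longrightarrow> smooth_on S (\<lambda>x. inverse (f x))"
  unfolding smooth_on_def using C_k_on_inverse by blast

lemma smooth_on_divide:
  fixes f g :: "'a::real_normed_vector \<Rightarrow> real"
  assumes "open S" "smooth_on S f" "smooth_on S g" "\<And>x. x \<in> S \<Longrightarrow> g x \<noteq> 0"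
  shows "smooth_on S (\<lambda>x. f x / g x)"
  unfolding divide_inverse by (intro smooth_on_mult smooth_on_inverse assms)

lemma smooth_on_power:
  fixes f :: "'a::real_normed_vector \<Rightarrow> real"
  assumes "open S" "smooth_on S f"
  shows "smooth_on S (\<lambda>x. f x ^ n)"
  by (induction n) (auto intro: smooth_on_mult smooth_on_const assms)

lemma smooth_on_imp_differentiable:
  assumes "smooth_on S f" "p \<in> S"
  shows "f differentiable (at p)"
  using assms unfolding smooth_on_def by (metis C_k_on.simps(2))

lemma smooth_on_imp_continuous_on: "smooth_on S f \<Longrightarrow> continuous_on S f"
  unfolding smooth_on_def by (metis C_k_on.simps(1))


section \<open>Partial derivatives in the plane\<close>

text \<open>Restricting the full derivative to the two axes gives the derivatives of the slices,
  which are \<open>pd1\<close> and \<open>pd2\<close>; linearity recovers the full derivative from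
  them.\<close>

lemma has_derivative_pd:
  assumes "f differentiable (at p)"
  shows "(f has_derivative (\<lambda>v. fst v * pd1 f p + snd v * pd2 f p)) (at p)"
    and "((\<lambda>t. f (t, snd p)) has_real_derivative pd1 f p) (at (fst p))"
    and "((\<lambda>t. f (fst p, t)) has_real_derivative pd2 f p) (at (snd p))"
proof -
  define D where "D = frechet_derivative f (at p)"
  have D: "(f has_derivative D) (at p)"
    using assms unfolding D_def frechet_derivative_works .
  then interpret D: bounded_linear D
    by (rule has_derivative_bounded_linear)
  have "((\<lambda>t. f (t, snd p)) has_derivative (\<lambda>h. D (h, 0))) (at (fst p))"
    by (rule has_derivative_compose[where g = f]) (auto intro!: derivative_eq_intros D)
  then have 1: "((\<lambda>t. f (t, snd p)) has_real_derivative D (1, 0)) (at (fst p))"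
    by (rule has_derivative_imp_has_field_derivative)
      (metis D.scaleR real_scaleR_def mult.commute mult.right_neutral
        mult_zero_right scaleR_Pair)
  have "((\<lambda>t. f (fst p, t)) has_derivative (\<lambda>h. D (0, h))) (at (snd p))"
    by (rule has_derivative_compose[where g = f]) (auto intro!: derivative_eq_intros D)
  then have 2: "((\<lambda>t. f (fst p, t)) has_real_derivative D (0, 1)) (at (snd p))"
    by (rule has_derivative_imp_has_field_derivative)
      (metis D.scaleR real_scaleR_def mult.commute mult.right_neutral
        mult_zero_right scaleR_Pair)
  have pd: "pd1 f p = D (1, 0)" "pd2 f p = D (0, 1)"
    using 1 2 by (auto simp: pd1_def pd2_def DERIV_imp_deriv)
  show "((\<lambda>t. f (t, snd p)) has_real_derivative pd1 f p) (at (fst p))"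
    "((\<lambda>t. f (fst p, t)) has_real_derivative pd2 f p) (at (snd p))"
    using 1 2 pd by auto
  have "D v = fst v * pd1 f p + snd v * pd2 f p" for v
  proof -
    have "v = fst v *\<^sub>R (1, 0) + snd v *\<^sub>R (0, 1)"
      by (cases v) simp
    then have "D v = D (fst v *\<^sub>R (1, 0) + snd v *\<^sub>R (0, 1))"
      by simp
    then show ?thesis
      by (simp only: D.add D.scaleR pd) simp
  qed
  then show "(f has_derivative (\<lambda>v. fst v * pd1 f p + snd v * pd2 f p)) (at p)"
    using D by presburger
qed

lemmas DERIV_pd1 = has_derivative_pd(2)[where p = "(x, y)" for x y, simplified]
lemmas DERIV_pd2 = has_derivative_pd(3)[where p = "(x, y)" for x y, simplified]

lemma pd_unique:
  assumes "(f has_derivative (\<lambda>v. fst v * a + snd v * b)) (at p)"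
  shows "pd1 f p = a" "pd2 f p = b"
proof -
  have "f differentiable (at p)"
    using assms by (auto simp: differentiable_def)
  from has_derivative_unique[OF assms has_derivative_pd(1)[OF this]]
  have *: "fst v * a + snd v * b = fst v * pd1 f p + snd v * pd2 f p" for v
    by meson
  show "pd1 f p = a" "pd2 f p = b"
    using *[of "(1, 0)"] *[of "(0, 1)"] by auto
qed

lemma pd1_eqI: "((\<lambda>t. f (t, y)) has_real_derivative d) (at x) \<Longrightarrow> pd1 f (x, y) = d"
  by (simp add: pd1_def DERIV_imp_deriv)

lemma pd2_eqI: "((\<lambda>t. f (x, t)) has_real_derivative d) (at y) \<Longrightarrow> pd2 f (x, y) = d"
  by (simp add: pd2_def DERIV_imp_deriv)

lemma pd_cong:
  assumes "open S" "p \<in> S" "\<And>x. x \<in> S \<Longrightarrow> f x = g x" "f differentiable (at p)"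
  shows "pd1 g p = pd1 f p" "pd2 g p = pd2 f p"
  using pd_unique[OF has_derivative_transform_within_open[OF has_derivative_pd(1)[OF assms(4)] assms(1-3)]]
  by auto

text \<open>The direction enters only through its two coordinates, so the regularity of the two
  coefficient functions controls all directional derivatives.\<close>

lemma C_k_on_Suc_pd:
  fixes f :: "real \<times> real \<Rightarrow> real"
  assumes "open S" "\<And>p. p \<in> S \<Longrightarrow> (f has_derivative (\<lambda>v. fst v * a p + snd v * b p)) (at p)"
    and "C_k_on k S a" "C_k_on k S b"
  shows "C_k_on (Suc k) S f"
proof (rule C_k_on_SucI[OF assms(1,2)])
  show "C_k_on k S (\<lambda>p. fst v * a p + snd v * b p)" for v
    by (intro C_k_on_add C_k_on_mult C_k_on_const assms(1,3,4))
qed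

lemma C_k_on_Suc_pdD:
  assumes "open S" "C_k_on (Suc k) S f"
  shows "C_k_on k S (pd1 f)" "C_k_on k S (pd2 f)"
proof -
  have *: "frechet_derivative f (at x) v = fst v * pd1 f x + snd v * pd2 f x" if "x \<in> S" for x v
    using has_derivative_pd(1)[of f x] that assms
    by (simp add: frechet_derivative_at[symmetric])
  show "C_k_on k S (pd1 f)"
    by (rule C_k_on_cong[OF assms(1), where f = "\<lambda>x. frechet_derivative f (at x) (1, 0)"])
      (use assms * in auto)
  show "C_k_on k S (pd2 f)"
    by (rule C_k_on_cong[OF assms(1), where f = "\<lambda>x. frechet_derivative f (at x) (0, 1)"])
      (use assms * in auto)
qed

lemma smooth_on_pd:
  assumes "open S" "smooth_on S f"
  shows "smooth_on S (pd1 f)" "smooth_on S (pd2 f)"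
  using assms C_k_on_Suc_pdD unfolding smooth_on_def by blast+

lemma smooth_on_fst: "open S \<Longrightarrow> smooth_on S (\<lambda>p::real \<times> real. fst p)"
  by (simp add: smooth_on_def C_k_on_bounded_linear bounded_linear_fst)

text \<open>Sine and cosine are each other's derivatives up to sign, hence the joint
  induction.\<close>

lemma smooth_on_sin_cos:
  assumes "open (S :: (real \<times> real) set)"
  shows "smooth_on S (\<lambda>p. sin (snd p))" "smooth_on S (\<lambda>p. cos (snd p))"
proof -
  have "C_k_on k S (\<lambda>p. sin (snd p)) \<and> C_k_on k S (\<lambda>p. cos (snd p))" for k
  proof (induction k)
    case 0
    show ?case by (auto intro!: continuous_intros)
  next
    case (Suc k)
    have "C_k_on (Suc k) S (\<lambda>p. sin (snd p))"
      by (rule C_k_on_Suc_pd[OF assms, where a = "\<lambda>p. 0" and b = "\<lambda>p. cos (snd p)"])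
        (auto intro!: derivative_eq_intros C_k_on_const assms simp: Suc)
    moreover have "C_k_on (Suc k) S (\<lambda>p. cos (snd p))"
    proof (rule C_k_on_Suc_pd[OF assms, where a = "\<lambda>p. 0" and b = "\<lambda>p. - 1 * sin (snd p)"])
      show "C_k_on k S (\<lambda>p. - 1 * sin (snd p))"
        using Suc by (intro C_k_on_mult C_k_on_const assms) auto
    qed (auto intro!: derivative_eq_intros C_k_on_const assms)
    ultimately show ?case by blast
  qed
  then show "smooth_on S (\<lambda>p. sin (snd p))" "smooth_on S (\<lambda>p. cos (snd p))"
    by (auto simp: smooth_on_def)
qed

section \<open>Changing the first coordinate\<close>

lemma has_derivative_reparam:
  assumes "(\<phi> has_real_derivative d) (at (fst p))"
    and "f differentiable (at (\<phi> (fst p), snd p))"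
  shows "((\<lambda>p. f (\<phi> (fst p), snd p)) has_derivative
           (\<lambda>v. fst v * (d * pd1 f (\<phi> (fst p), snd p)) + snd v * pd2 f (\<phi> (fst p), snd p))) (at p)"
proof -
  have "(\<phi> has_derivative (\<lambda>h. d * h)) (at (fst p))"
    using assms(1) by (simp add: has_field_derivative_def)
  then have "((\<lambda>p. \<phi> (fst p)) has_derivative (\<lambda>v. d * fst v)) (at p)"
    by (rule has_derivative_compose[rotated]) (auto intro: derivative_intros)
  then have "((\<lambda>p. (\<phi> (fst p), snd p)) has_derivative (\<lambda>v. (d * fst v, snd v))) (at p)"
    by (auto intro!: derivative_eq_intros)
  from has_derivative_compose[OF this has_derivative_pd(1)[OF assms(2)]]
  show ?thesis
    by (simp add: algebra_simps)
qed

text \<open>The summand \<open>snd v * 0\<close> gives the derivative the shape that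
  \<open>C_k_on_Suc_pd\<close> expects, with vanishing second coefficient.\<close>

lemma has_derivative_fst_fun:
  assumes "(\<phi> has_real_derivative d) (at (fst p))"
  shows "((\<lambda>p. \<phi> (fst p)) has_derivative (\<lambda>v. fst v * d + snd v * 0)) (at p)"
proof -
  have "(\<phi> has_derivative (\<lambda>h. d * h)) (at (fst p))"
    using assms(1) by (simp add: has_field_derivative_def)
  then have "((\<lambda>p. \<phi> (fst p)) has_derivative (\<lambda>v. d * fst v)) (at p)"
    by (rule has_derivative_compose[rotated]) (auto intro: derivative_intros)
  then show ?thesis by (simp add: mult.commute)
qed

lemma smooth_on_reparam:
  fixes f :: "real \<times> real \<Rightarrow> real"
  assumes "open S" "open T" and maps: "\<And>p. p \<in> T \<Longrightarrow> (\<phi> (fst p), snd p) \<in> S"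
    and D: "\<And>p. p \<in> T \<Longrightarrow> (\<phi> has_real_derivative \<psi> p) (at (fst p))"
    and \<psi>: "smooth_on T \<psi>" and f: "smooth_on S f"
  shows "smooth_on T (\<lambda>p. f (\<phi> (fst p), snd p))"
proof -
  \<comment> \<open>One order of \<open>f\<close> is spent so that continuity in the base case comes
    from the chain rule; \<open>f\<close> is arbitrary because the step passes to its partial
    derivatives.\<close>
  have C: "C_k_on k T (\<lambda>p. f (\<phi> (fst p), snd p))" if "C_k_on (Suc k) S f" for k and f :: "real \<times> real \<Rightarrow> real"
    using that
  proof (induction k arbitrary: f)
    case 0
    have "isCont (\<lambda>p. f (\<phi> (fst p), snd p)) p" if "p \<in> T" for p
      using has_derivative_continuous[OF has_derivative_reparam[OF D[OF that]]] 0 maps that by auto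
    then show ?case by (simp add: continuous_at_imp_continuous_on)
  next
    case (Suc k)
    have "C_k_on k T \<psi>"
      using \<psi> by (simp add: smooth_on_def)
    with Suc C_k_on_Suc_pdD[OF \<open>open S\<close> Suc.prems] show ?case
      by (intro C_k_on_Suc_pd[OF \<open>open T\<close> has_derivative_reparam[OF D]] C_k_on_mult \<open>open T\<close>)
        (use maps in auto)
  qed
  from f show ?thesis unfolding smooth_on_def by (blast intro: C)
qed

text \<open>The derivative of \<open>\<phi>\<close> is only known in terms of \<open>\<phi>\<close> itself, so its smoothness cannot be
  presupposed; the induction bootstraps it.\<close>

lemma smooth_on_autonomous_reparam:
  fixes f :: "real \<times> real \<Rightarrow> real"
  assumes "open S" "open T" and maps: "\<And>p. p \<in> T \<Longrightarrow> (\<phi> (fst p), snd p) \<in> S"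
    and D: "\<And>p. p \<in> T \<Longrightarrow> (\<phi> has_real_derivative \<psi> (\<phi> (fst p), snd p)) (at (fst p))"
    and \<psi>: "smooth_on S \<psi>" and f: "smooth_on S f"
  shows "smooth_on T (\<lambda>p. f (\<phi> (fst p), snd p))"
proof -
  have "C_k_on k T (\<lambda>p. f (\<phi> (fst p), snd p))" if "smooth_on S f" for k and f :: "real \<times> real \<Rightarrow> real"
    using that
  proof (induction k arbitrary: f)
    case 0
    have "isCont (\<lambda>p. f (\<phi> (fst p), snd p)) p" if "p \<in> T" for p
      using has_derivative_continuous[OF has_derivative_reparam[OF D[OF that]]]
        smooth_on_imp_differentiable[OF 0 maps[OF that]] by auto
    then show ?case by (simp add: continuous_at_imp_continuous_on)
  next
    case (Suc k)
    \<comment> \<open>The product of \<open>\<psi>\<close> and \<open>pd1 f\<close> is again smooth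
      on \<open>S\<close>, so the induction hypothesis covers its composite at order
      \<open>k\<close>.\<close>
    have "C_k_on k T (\<lambda>p. \<psi> (\<phi> (fst p), snd p) * pd1 f (\<phi> (fst p), snd p))"
      by (rule Suc.IH[where f = "\<lambda>x. \<psi> x * pd1 f x"])
        (intro smooth_on_mult smooth_on_pd \<open>open S\<close> \<psi> Suc.prems)
    moreover have "C_k_on k T (\<lambda>p. pd2 f (\<phi> (fst p), snd p))"
      by (rule Suc.IH) (intro smooth_on_pd \<open>open S\<close> Suc.prems)
    ultimately show ?case
      using maps smooth_on_imp_differentiable[OF Suc.prems]
      by (intro C_k_on_Suc_pd[OF \<open>open T\<close> has_derivative_reparam[OF D]]) blast+
  qed
  with f show ?thesis by (simp add: smooth_on_def)
qed

section \<open>Symmetry of mixed partial derivatives\<close>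

lemma second_difference_mean_value:
  fixes f :: "real \<Rightarrow> real \<Rightarrow> real"
  assumes "h > 0"
    and D1: "\<And>s t. \<lbrakk>x \<le> s; s \<le> x + h; y \<le> t; t \<le> y + h\<rbrakk> \<Longrightarrow> ((\<lambda>s. f s t) has_real_derivative f1 s t) (at s)"
    and D2: "\<And>s t. \<lbrakk>x \<le> s; s \<le> x + h; y \<le> t; t \<le> y + h\<rbrakk> \<Longrightarrow> ((\<lambda>t. f1 s t) has_real_derivative f12 s t) (at t)"
  obtains s t where "x < s" "s < x + h" "y < t" "t < y + h"
    "f (x + h) (y + h) - f (x + h) y - f x (y + h) + f x y = h * h * f12 s t"
proof -
  \<comment> \<open>The mean value theorem is applied to the increment
    \<open>f s (y + h) - f s y\<close> as a function of \<open>s\<close>; a second application, in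
    \<open>t\<close>, follows.\<close>
  have "\<exists>s. x < s \<and> s < x + h \<and> (f (x + h) (y + h) - f (x + h) y) - (f x (y + h) - f x y) =
      (x + h - x) * (f1 s (y + h) - f1 s y)"
    by (rule MVT2) (use \<open>h > 0\<close> in \<open>auto intro!: DERIV_diff D1\<close>)
  then obtain s where s: "x < s" "s < x + h" and
    *: "(f (x + h) (y + h) - f (x + h) y) - (f x (y + h) - f x y) = h * (f1 s (y + h) - f1 s y)"
    by auto
  have "\<exists>t. y < t \<and> t < y + h \<and> f1 s (y + h) - f1 s y = (y + h - y) * f12 s t"
    by (rule MVT2) (use \<open>h > 0\<close> s in \<open>auto intro!: D2\<close>)
  then obtain t where "y < t" "t < y + h" "f1 s (y + h) - f1 s y = h * f12 s t"
    by auto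
  with s * show ?thesis
    by (intro that[of s t]) (auto simp: algebra_simps)
qed

text \<open>The second difference over a square is unchanged when the coordinates are swapped, and
  it equals \<open>h * h\<close> times either mixed derivative at some point of the square. If the
  two differed at \<open>p\<close>, continuity would keep them apart on a small square.\<close>

lemma pd1_pd2_commute:
  assumes "open S" "smooth_on S f" "p \<in> S"
  shows "pd1 (pd2 f) p = pd2 (pd1 f) p"
proof (rule ccontr)
  assume neq: "pd1 (pd2 f) p \<noteq> pd2 (pd1 f) p"
  obtain x y where p: "p = (x, y)" by (cases p)
  \<comment> \<open>Half the gap: values within \<open>e\<close> of the two distinct derivatives
    cannot coincide.\<close>
  define e where "e = \<bar>pd1 (pd2 f) p - pd2 (pd1 f) p\<bar> / 2"
  have "e > 0" using neq by (simp add: e_def)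
  have cont: "continuous (at p) (pd1 (pd2 f))" "continuous (at p) (pd2 (pd1 f))"
    using assms by (meson continuous_on_eq_continuous_at smooth_on_imp_continuous_on smooth_on_pd)+
  obtain d1 where d1: "d1 > 0" "\<And>z. dist z p < d1 \<Longrightarrow> dist (pd1 (pd2 f) z) (pd1 (pd2 f) p) < e"
    using cont(1) \<open>e > 0\<close> unfolding continuous_at_eps_delta by blast
  obtain d2 where d2: "d2 > 0" "\<And>z. dist z p < d2 \<Longrightarrow> dist (pd2 (pd1 f) z) (pd2 (pd1 f) p) < e"
    using cont(2) \<open>e > 0\<close> unfolding continuous_at_eps_delta by blast
  obtain d3 where d3: "d3 > 0" "ball p d3 \<subseteq> S"
    using assms open_contains_ball by blast
  \<comment> \<open>Points of the square of side \<open>h\<close> with corner \<open>p\<close> lie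
    within \<open>2 * h\<close> of \<open>p\<close>, hence strictly within all three radii.\<close>
  define h where "h = min d1 (min d2 d3) / 3"
  have h: "h > 0" "3 * h \<le> d1" "3 * h \<le> d2" "3 * h \<le> d3"
    using d1(1) d2(1) d3(1) by (auto simp: h_def)
  have close: "dist (s, t) p < 3 * h" if "x \<le> s" "s \<le> x + h" "y \<le> t" "t \<le> y + h" for s t
  proof -
    have "dist (s, t) (x, y) \<le> dist s x + dist t y"
      by (simp add: dist_prod_def sqrt_sum_squares_le_sum)
    also have "\<dots> < 3 * h"
      using that \<open>h > 0\<close> by (simp add: dist_real_def)
    finally show ?thesis by (simp add: p)
  qed
  have S: "(s, t) \<in> S" if "x \<le> s" "s \<le> x + h" "y \<le> t" "t \<le> y + h" for s t
    using close[OF that] h(4) d3(2) by (auto simp: dist_commute)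
  have df: "f differentiable (at (s, t))" "pd1 f differentiable (at (s, t))" "pd2 f differentiable (at (s, t))"
    if "x \<le> s" "s \<le> x + h" "y \<le> t" "t \<le> y + h" for s t
    using S[OF that] assms smooth_on_pd smooth_on_imp_differentiable by blast+
  obtain s t where st: "x < s" "s < x + h" "y < t" "t < y + h"
    "f (x + h, y + h) - f (x + h, y) - f (x, y + h) + f (x, y) = h * h * pd2 (pd1 f) (s, t)"
    by (rule second_difference_mean_value[of h x y "\<lambda>s t. f (s, t)" "\<lambda>s t. pd1 f (s, t)" "\<lambda>s t. pd2 (pd1 f) (s, t)"])
      (use \<open>h > 0\<close> in \<open>auto intro!: DERIV_pd1 DERIV_pd2 df\<close>)
  obtain s' t' where st': "y < t'" "t' < y + h" "x < s'" "s' < x + h"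
    "f (x + h, y + h) - f (x, y + h) - f (x + h, y) + f (x, y) = h * h * pd1 (pd2 f) (s', t')"
    by (rule second_difference_mean_value[of h y x "\<lambda>t s. f (s, t)" "\<lambda>t s. pd2 f (s, t)" "\<lambda>t s. pd1 (pd2 f) (s, t)"])
      (use \<open>h > 0\<close> in \<open>auto intro!: DERIV_pd1 DERIV_pd2 df\<close>)
  have "h * h * pd2 (pd1 f) (s, t) = h * h * pd1 (pd2 f) (s', t')"
    using st(5) st'(5) by linarith
  then have "pd2 (pd1 f) (s, t) = pd1 (pd2 f) (s', t')"
    using \<open>h > 0\<close> by simp
  moreover have "dist (pd2 (pd1 f) (s, t)) (pd2 (pd1 f) p) < e"
    using close[of s t] st h by (intro d2) auto
  moreover have "dist (pd1 (pd2 f) (s', t')) (pd1 (pd2 f) p) < e"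
    using close[of s' t'] st' h by (intro d1) auto
  ultimately show False
    unfolding e_def dist_real_def by (smt (verit) field_sum_of_halves)
qed


section \<open>The gas law\<close>

lemma open_rho_theta_domain: "open rho_theta_domain"
  by (simp add: rho_theta_domain_def open_Times)

lemma q_of_pos:
  assumes "g \<ge> 1" "r \<in> {0<..<1}"
  shows "q_of g r > 0"
  using bij_betw_density_formula(2)[OF assms] q_of_eq[OF assms]
  by (auto simp: speeds_def split: if_splits)

text \<open>The speed stays below the cavitation speed, which makes the radicand positive. For
  \<open>g = 1\<close> the coefficient \<open>(g - 1) / 2\<close> vanishes, so one formula for
  \<open>c^2\<close> serves both gas laws.\<close>

lemma c_of_pos_square:
  assumes "g \<ge> 1" "r \<in> {0<..<1}"
  shows "c_of g r > 0" "(c_of g r)\<^sup>2 = 1 - (g - 1) / 2 * (q_of g r)\<^sup>2"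
proof -
  have "c_of g r > 0 \<and> (c_of g r)\<^sup>2 = 1 - (g - 1) / 2 * (q_of g r)\<^sup>2"
  proof (cases "g = 1")
    case True
    then show ?thesis by (simp add: c_of_def sound_speed_def)
  next
    case False
    with assms have g: "g > 1" by simp
    have "q_of g r < sqrt (2 / (g - 1))"
      using bij_betw_density_formula(2)[OF assms] q_of_eq[OF assms] False by (auto simp: speeds_def)
    then have "(q_of g r)\<^sup>2 < (sqrt (2 / (g - 1)))\<^sup>2"
      by (rule power_strict_mono) (use q_of_pos[OF assms] in auto)
    with g have "(g - 1) / 2 * (q_of g r)\<^sup>2 < 1"
      by (auto simp: field_simps)
    with False show ?thesis
      by (simp add: c_of_def sound_speed_def)
  qed
  then show "c_of g r > 0" "(c_of g r)\<^sup>2 = 1 - (g - 1) / 2 * (q_of g r)\<^sup>2"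
    by auto
qed

text \<open>This is Bernoulli's law in differential form. It is read off from the explicit
  \<open>speed_formula\<close>, which agrees with \<open>q_of\<close> on an open interval.\<close>

lemma DERIV_q_of:
  assumes g: "g \<ge> 1" and r: "r \<in> {0<..<1}"
  shows "(q_of g has_real_derivative - ((c_of g r)\<^sup>2 / (r * q_of g r))) (at r)"
proof -
  have "(speed_formula g has_real_derivative - ((c_of g r)\<^sup>2 / (r * q_of g r))) (at r)"
  proof (cases "g = 1")
    case True
    have "((\<lambda>r. sqrt (- 2 * ln r)) has_real_derivative - (1 / (r * sqrt (- 2 * ln r)))) (at r)"
      using r by (auto intro!: derivative_eq_intros simp: divide_simps)
    with True show ?thesis
      using q_of_eq[OF g r] by (simp add: c_of_def sound_speed_def speed_formula_def[abs_def])
  next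
    case False
    with g have g': "g > 1" by simp
    have q: "q_of g r = sqrt (2 / (g - 1) * (1 - r powr (g - 1)))"
      using False q_of_eq[OF g r] by (simp add: speed_formula_def)
    then have "2 / (g - 1) * (1 - r powr (g - 1)) > 0"
      using q_of_pos[OF g r] by (metis real_sqrt_gt_0_iff)
    then have q2: "(q_of g r)\<^sup>2 = 2 / (g - 1) * (1 - r powr (g - 1))"
      unfolding q by (intro real_sqrt_pow2) simp
    \<comment> \<open>This identifies the power of \<open>r\<close> produced by the differentiation
      below as \<open>c^2 / r\<close>.\<close>
    then have c: "(c_of g r)\<^sup>2 = r powr (g - 1)"
      using g' by (simp add: c_of_pos_square[OF g r] divide_simps) (simp add: algebra_simps)
    have "((\<lambda>r. sqrt (2 / (g - 1) * (1 - r powr (g - 1)))) has_real_derivative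
        inverse (q_of g r) / 2 * (2 / (g - 1) * (0 - (g - 1) * r powr (g - 1 - 1)))) (at r)"
      unfolding q using r \<open>2 / (g - 1) * (1 - r powr (g - 1)) > 0\<close>
      by (intro DERIV_real_sqrt[THEN DERIV_chain2] DERIV_cmult DERIV_diff DERIV_const has_real_derivative_powr) auto
    moreover have "inverse (q_of g r) / 2 * (2 / (g - 1) * (0 - (g - 1) * r powr (g - 1 - 1))) =
        - ((c_of g r)\<^sup>2 / (r * q_of g r))"
      using g' r q_of_pos[OF g r] unfolding c by (simp add: powr_diff field_simps power2_eq_square)
    ultimately show ?thesis
      using False by (simp add: speed_formula_def[abs_def])
  qed
  then show ?thesis
    by (rule has_field_derivative_transform_within_open[of _ _ _ "{0<..<1}"])
      (use r q_of_eq[OF g] in auto)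
qed

text \<open>Eliminating \<open>c^2\<close> leaves \<open>1 - (g + 1) / 2 * q^2\<close>, whose
  derivative follows from that of \<open>q\<close>. Since it is positive, the sonic speed is crossed
  transversally.\<close>

lemma DERIV_c_sq_minus_q_sq:
  assumes g: "g \<ge> 1" and r: "r \<in> {0<..<1}"
  shows "((\<lambda>r. (c_of g r)\<^sup>2 - (q_of g r)\<^sup>2) has_real_derivative (g + 1) * (c_of g r)\<^sup>2 / r) (at r)"
proof (rule has_field_derivative_transform_within_open[of _ _ _ "{0<..<1}"])
  show "((\<lambda>r. 1 - (g + 1) / 2 * (q_of g r)\<^sup>2) has_real_derivative (g + 1) * (c_of g r)\<^sup>2 / r) (at r)"
    using q_of_pos[OF g r] r
    by (auto intro!: derivative_eq_intros DERIV_q_of[OF g r] simp: field_simps)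
qed (use r c_of_pos_square[OF g] in \<open>auto simp: field_simps\<close>)

text \<open>A function vanishing near \<open>r\<close> has derivative zero there, whereas
  \<open>c^2 - q^2\<close> has a positive one. Every neighbourhood of \<open>r\<close> thus contains
  non-sonic densities, which allows identities to be extended to the sonic line by
  continuity.\<close>

lemma not_eventually_sonic:
  assumes g: "g \<ge> 1" and r: "r \<in> {0<..<1}"
  shows "\<not> (\<forall>\<^sub>F s in nhds r. q_of g s = c_of g s)"
proof
  assume "\<forall>\<^sub>F s in nhds r. q_of g s = c_of g s"
  then have "\<forall>\<^sub>F s in nhds r. (c_of g s)\<^sup>2 - (q_of g s)\<^sup>2 = 0"
    by eventually_elim simp
  then have "((\<lambda>s. 0) has_real_derivative (g + 1) * (c_of g r)\<^sup>2 / r) (at r)"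
    using DERIV_c_sq_minus_q_sq[OF g r]
      DERIV_cong_ev[of r r "\<lambda>s. (c_of g s)\<^sup>2 - (q_of g s)\<^sup>2" "\<lambda>s. 0", OF refl _ refl] by blast
  then have "(g + 1) * (c_of g r)\<^sup>2 / r = 0"
    using DERIV_const DERIV_unique by blast
  with g r c_of_pos_square(1)[OF g r] show False
    by auto
qed

text \<open>Bootstrapping: \<open>q\<close> solves the differential equation \<open>q' = ((g - 1) / 2 q\<^sup>2 - 1) / (r q)\<close>.\<close>

lemma smooth_on_q_of:
  assumes g: "g \<ge> 1"
  shows "smooth_on rho_theta_domain (\<lambda>p. q_of g (fst p))"
proof -
  let ?D = rho_theta_domain
  note o = open_rho_theta_domain
  have mem: "fst p \<in> {0<..<1}" if "p \<in> ?D" for p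
    using that by (auto simp: rho_theta_domain_def)
  have der: "((\<lambda>p. q_of g (fst p)) has_derivative (\<lambda>v. fst v *
        (((g - 1) / 2 * (q_of g (fst p) * q_of g (fst p)) + - 1) * (inverse (fst p) * inverse (q_of g (fst p))))
          + snd v * 0)) (at p)" if "p \<in> ?D" for p
  proof -
    \<comment> \<open>Eliminating \<open>c^2\<close> makes the right-hand side rational in
      \<open>r\<close> and \<open>q\<close>, within reach of the closure rules for sums, products
      and inverses.\<close>
    have "- ((c_of g (fst p))\<^sup>2 / (fst p * q_of g (fst p))) =
        ((g - 1) / 2 * (q_of g (fst p) * q_of g (fst p)) + - 1) * (inverse (fst p) * inverse (q_of g (fst p)))"
      using mem[OF that] q_of_pos[OF g mem[OF that]] c_of_pos_square(2)[OF g mem[OF that]]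
      by (simp add: field_simps power2_eq_square)
    then show ?thesis
      using has_derivative_fst_fun[where p = p, OF DERIV_q_of[OF g mem[OF that]]] by simp
  qed
  have nz: "fst p \<noteq> 0" "q_of g (fst p) \<noteq> 0" if "p \<in> ?D" for p
    using mem[OF that] q_of_pos[OF g mem[OF that]] by auto
  have "C_k_on k ?D (\<lambda>p. q_of g (fst p))" for k
  proof (induction k)
    case 0
    have "isCont (\<lambda>p. q_of g (fst p)) p" if "p \<in> ?D" for p
      using has_derivative_continuous[OF der[OF that]] .
    then show ?case by (simp add: continuous_at_imp_continuous_on)
  next
    case (Suc k)
    have "C_k_on k ?D (\<lambda>p. fst p)"
      by (rule C_k_on_bounded_linear[OF o bounded_linear_fst])
    with Suc nz show ?case
      by (intro C_k_on_Suc_pd[OF o der] C_k_on_mult C_k_on_add C_k_on_inverse C_k_on_const o)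
  qed
  then show ?thesis by (simp add: smooth_on_def)
qed

lemma smooth_on_c_of_sq:
  assumes g: "g \<ge> 1"
  shows "smooth_on rho_theta_domain (\<lambda>p. (c_of g (fst p))\<^sup>2)"
proof (rule smooth_on_cong[OF open_rho_theta_domain])
  show "smooth_on rho_theta_domain (\<lambda>p. 1 - (g - 1) / 2 * (q_of g (fst p))\<^sup>2)"
    by (intro smooth_on_diff smooth_on_const smooth_on_mult smooth_on_power smooth_on_q_of[OF g]
        open_rho_theta_domain)
qed (use c_of_pos_square[OF g] in \<open>auto simp: rho_theta_domain_def\<close>)

text \<open>The positive derivative makes \<open>\<mu>\<close> strictly increasing, hence injective,
  and a continuous injection of an interval is open. The inverse \<open>\<rho>\<close> turns
  functions of the density into functions of \<open>\<mu>\<close>.\<close>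

lemma mu_function_inverse:
  assumes g: "g \<ge> 1" and \<mu>: "mu_function g \<mu>"
  obtains \<rho> where "open (mu_theta_domain \<mu>)"
    "\<And>r. r \<in> {0<..<1} \<Longrightarrow> \<rho> (\<mu> r) = r"
    "\<And>r. r \<in> {0<..<1} \<Longrightarrow> (\<rho> has_real_derivative (q_of g r)\<^sup>2 / (c_of g r)\<^sup>2) (at (\<mu> r))"
proof -
  let ?I = "{0<..<1::real}"
  have D: "(\<mu> has_real_derivative (c_of g r)\<^sup>2 / (q_of g r)\<^sup>2) (at r)" if "r \<in> ?I" for r
    using \<mu> that by (simp add: mu_function_def)
  have pos: "(c_of g r)\<^sup>2 / (q_of g r)\<^sup>2 > 0" if "r \<in> ?I" for r
    using q_of_pos[OF g that] c_of_pos_square(1)[OF g that] by simp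
  have less: "\<mu> a < \<mu> b" if "a \<in> ?I" "b \<in> ?I" "a < b" for a b
  proof (rule DERIV_pos_imp_increasing[OF \<open>a < b\<close>])
    fix x assume "a \<le> x" "x \<le> b"
    with that have "x \<in> ?I" by auto
    then show "\<exists>y. (\<mu> has_real_derivative y) (at x) \<and> y > 0"
      using D pos by blast
  qed
  have inj: "inj_on \<mu> ?I"
    by (rule inj_onI) (metis less less_irrefl linorder_neqE)
  have cont: "continuous_on ?I \<mu>"
    using D DERIV_isCont continuous_at_imp_continuous_on by blast
  have op: "open (\<mu> ` ?I)"
    by (rule injective_into_1d_imp_open_map_UNIV[OF _ cont inj]) auto
  define \<rho> where "\<rho> = the_inv_into ?I \<mu>"
  have inv: "\<rho> (\<mu> r) = r" if "r \<in> ?I" for r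
    unfolding \<rho>_def by (rule the_inv_into_f_f[OF inj that])
  have "(\<rho> has_real_derivative (q_of g r)\<^sup>2 / (c_of g r)\<^sup>2) (at (\<mu> r))" if "r \<in> ?I" for r
  proof -
    have "(\<rho> has_derivative (\<lambda>h. (q_of g r)\<^sup>2 / (c_of g r)\<^sup>2 * h)) (at (\<mu> r))"
    proof (rule has_derivative_inverse_strong[OF _ that cont inv])
      show "(\<mu> has_derivative (\<lambda>h. (c_of g r)\<^sup>2 / (q_of g r)\<^sup>2 * h)) (at r)"
        using D[OF that] unfolding has_field_derivative_def .
      show "(\<lambda>h. (c_of g r)\<^sup>2 / (q_of g r)\<^sup>2 * h) \<circ> (\<lambda>h. (q_of g r)\<^sup>2 / (c_of g r)\<^sup>2 * h) = id"
        using pos[OF that] by (auto simp: fun_eq_iff)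
    qed auto
    then show ?thesis unfolding has_field_derivative_def .
  qed
  with op inv show ?thesis
    by (intro that[of \<rho>]) (auto simp: mu_theta_domain_def open_Times)
qed


section \<open>Entropy pairs and their generators\<close>

lemma rho_theta_domain_iff [simp]: "(r, \<theta>) \<in> rho_theta_domain \<longleftrightarrow> 0 < r \<and> r < 1"
  by (simp add: rho_theta_domain_def)

text \<open>The candidate \<open>h = V + P / q\<close> is transported to the variables of
  \<open>H\<close> by the inverse of \<open>\<mu>\<close>. Its first derivatives reduce to
  \<open>A\<close> and \<open>B\<close>, so the Tricomi equation is checked by differentiating each
  of these once.\<close>

lemma entropy_pair_imp_ex_generator:
  assumes g: "g \<ge> 1" and \<mu>: "mu_function g \<mu>" and EP: "entropy_pair g Q1 Q2"
  shows "\<exists>H. tricomi_solution g \<mu> H \<and> loewner_morawetz g \<mu> H Q1 Q2"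
proof -
  let ?D = rho_theta_domain and ?T = "mu_theta_domain \<mu>"
  let ?q = "q_of g" and ?c = "c_of g"
  note oD = open_rho_theta_domain
  obtain V W where Q1: "smooth_on ?D Q1" and Q2: "smooth_on ?D Q2"
    and V: "smooth_on ?D V" and W: "smooth_on ?D W"
    and eqs: "\<And>r \<theta>. r \<in> {0<..<1} \<Longrightarrow>
      (?q r \<noteq> ?c r \<longrightarrow> W (r, \<theta>) = pd1 V (r, \<theta>) / ((?c r)\<^sup>2 - (?q r)\<^sup>2)) \<and>
      pd1 Q1 (r, \<theta>) = (?c r)\<^sup>2 / (r * ?q r) * sin \<theta> * pd2 V (r, \<theta>) - ?q r * cos \<theta> * pd1 V (r, \<theta>) \<and>
      pd2 Q1 (r, \<theta>) = - ?q r * cos \<theta> * pd2 V (r, \<theta>) - r * ?q r ^ 3 * sin \<theta> * W (r, \<theta>) \<and>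
      pd1 Q2 (r, \<theta>) = - ((?c r)\<^sup>2 / (r * ?q r)) * cos \<theta> * pd2 V (r, \<theta>) - ?q r * sin \<theta> * pd1 V (r, \<theta>) \<and>
      pd2 Q2 (r, \<theta>) = - ?q r * sin \<theta> * pd2 V (r, \<theta>) + r * ?q r ^ 3 * cos \<theta> * W (r, \<theta>)"
    using EP unfolding entropy_pair_def Let_def by blast
  have q: "?q r > 0" and c: "?c r > 0" if "r \<in> {0<..<1}" for r
    using q_of_pos[OF g that] c_of_pos_square(1)[OF g that] by auto
  \<comment> \<open>Off the sonic line this is the defining property of \<open>W\<close>. A nonzero
    defect \<open>G\<close> at \<open>r\<close> would persist nearby by continuity and force all
    nearby densities to be sonic.\<close>
  have Vr: "pd1 V (r, \<theta>) = ((?c r)\<^sup>2 - (?q r)\<^sup>2) * W (r, \<theta>)" if r: "r \<in> {0<..<1}" for r \<theta>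
  proof (rule ccontr)
    define G where "G = (\<lambda>s. pd1 V (s, \<theta>) - ((?c s)\<^sup>2 - (?q s)\<^sup>2) * W (s, \<theta>))"
    assume "\<not> ?thesis"
    then have "G r \<noteq> 0" by (simp add: G_def)
    have "continuous_on ?D (\<lambda>p. pd1 V p - ((?c (fst p))\<^sup>2 - (?q (fst p))\<^sup>2) * W p)"
      by (intro smooth_on_imp_continuous_on smooth_on_diff smooth_on_mult smooth_on_pd(1) smooth_on_c_of_sq
          smooth_on_power smooth_on_q_of oD V W g)
    then have "continuous_on {0<..<1} (\<lambda>s. (\<lambda>p. pd1 V p - ((?c (fst p))\<^sup>2 - (?q (fst p))\<^sup>2) * W p) (s, \<theta>))"
      by (rule continuous_on_compose2) (auto intro!: continuous_intros)
    then have "isCont G r"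
      using r unfolding G_def by (simp add: continuous_on_eq_continuous_at)
    then have "\<forall>\<^sub>F s in nhds r. G s \<noteq> 0"
      using \<open>G r \<noteq> 0\<close> by (metis continuous_at_imp_continuous_at_within isCont_def tendsto_imp_eventually_ne tendsto_at_iff_tendsto_nhds)
    moreover have "\<forall>\<^sub>F s in nhds r. s \<in> {0<..<1}"
      using r by (intro eventually_nhds_in_open) auto
    ultimately have "\<forall>\<^sub>F s in nhds r. ?q s = ?c s"
    proof eventually_elim
      case (elim s)
      show ?case
      proof (rule ccontr)
        assume ne: "?q s \<noteq> ?c s"
        then have "(?c s)\<^sup>2 - (?q s)\<^sup>2 \<noteq> 0"
          using q[OF elim(2)] c[OF elim(2)] by (auto simp: power2_eq_iff_nonneg)
        moreover have "W (s, \<theta>) = pd1 V (s, \<theta>) / ((?c s)\<^sup>2 - (?q s)\<^sup>2)"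
          using eqs[OF elim(2)] ne by blast
        ultimately show False
          using elim(1) by (simp add: G_def)
      qed
    qed
    with not_eventually_sonic[OF g r] show False ..
  qed

  \<comment> \<open>Rotated components and the candidate generator\<close>
  define P where "P = (\<lambda>p. Q1 p * cos (snd p) + Q2 p * sin (snd p))"
  define N where "N = (\<lambda>p. Q2 p * cos (snd p) - Q1 p * sin (snd p))"
  \<comment> \<open>\<open>A\<close> and \<open>B\<close> are the values of
    \<open>H\<^sub>\<mu>\<close> and \<open>H\<^sub>\<theta>\<close> forced by the Loewner-Morawetz
    relation; \<open>h\<close> is the prospective generator in the variables
    \<open>(\<rho>, \<theta>)\<close>.\<close>
  define A where "A = (\<lambda>p. P p / (fst p * ?q (fst p)))"
  define B where "B = (\<lambda>p. N p / ?q (fst p))"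
  define h where "h = (\<lambda>p. V p + P p / ?q (fst p))"
  have nz: "fst p \<noteq> 0" "?q (fst p) \<noteq> 0" if "p \<in> ?D" for p
    using that q[of "fst p"] by (auto simp: rho_theta_domain_def)
  have smooth: "smooth_on ?D P" "smooth_on ?D N" "smooth_on ?D A" "smooth_on ?D B" "smooth_on ?D h"
    unfolding P_def N_def A_def B_def h_def
    using nz by (intro smooth_on_add smooth_on_diff smooth_on_mult smooth_on_divide smooth_on_sin_cos
        smooth_on_fst smooth_on_q_of oD Q1 Q2 V g; simp)+
  have D: "f differentiable (at (r, \<theta>))" if "smooth_on ?D f" "r \<in> {0<..<1}" for f :: "real \<times> real \<Rightarrow> real" and r \<theta>
    using that by (intro smooth_on_imp_differentiable[of ?D]) auto
  have pdP: "pd1 P (r, \<theta>) = - ?q r * pd1 V (r, \<theta>)" "pd2 P (r, \<theta>) = N (r, \<theta>) - ?q r * pd2 V (r, \<theta>)"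
    and pdN: "pd2 N (r, \<theta>) = r * ?q r ^ 3 * W (r, \<theta>) - P (r, \<theta>)" if r: "r \<in> {0<..<1}" for r \<theta>
  proof -
    note D1 = DERIV_pd1[OF D[OF Q1 r]] DERIV_pd1[OF D[OF Q2 r]]
    note D2 = DERIV_pd2[OF D[OF Q1 r]] DERIV_pd2[OF D[OF Q2 r]]
    \<comment> \<open>Naming the quotient leaves polynomial identities for \<open>algebra\<close>,
      with \<open>sc\<close> as the trigonometric input.\<close>
    define k where "k = (?c r)\<^sup>2 / (r * ?q r)"
    have e: "pd1 Q1 (r, \<theta>) = k * sin \<theta> * pd2 V (r, \<theta>) - ?q r * cos \<theta> * pd1 V (r, \<theta>)"
      "pd2 Q1 (r, \<theta>) = - ?q r * cos \<theta> * pd2 V (r, \<theta>) - r * ?q r ^ 3 * sin \<theta> * W (r, \<theta>)"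
      "pd1 Q2 (r, \<theta>) = - k * cos \<theta> * pd2 V (r, \<theta>) - ?q r * sin \<theta> * pd1 V (r, \<theta>)"
      "pd2 Q2 (r, \<theta>) = - ?q r * sin \<theta> * pd2 V (r, \<theta>) + r * ?q r ^ 3 * cos \<theta> * W (r, \<theta>)"
      using eqs[OF r, of \<theta>] by (auto simp: k_def)
    have sc: "(cos \<theta>)\<^sup>2 = 1 - (sin \<theta>)\<^sup>2"
      by (simp add: cos_squared_eq)
    have "pd1 P (r, \<theta>) = pd1 Q1 (r, \<theta>) * cos \<theta> + pd1 Q2 (r, \<theta>) * sin \<theta>"
      unfolding P_def by (rule pd1_eqI) (auto intro!: derivative_eq_intros D1)
    also have "\<dots> = - ?q r * pd1 V (r, \<theta>)"
      using e sc by algebra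
    finally show "pd1 P (r, \<theta>) = - ?q r * pd1 V (r, \<theta>)" .
    have "pd2 P (r, \<theta>) = pd2 Q1 (r, \<theta>) * cos \<theta> + pd2 Q2 (r, \<theta>) * sin \<theta> + N (r, \<theta>)"
      unfolding P_def N_def by (rule pd2_eqI) (auto intro!: derivative_eq_intros D2)
    also have "\<dots> = N (r, \<theta>) - ?q r * pd2 V (r, \<theta>)"
      using e sc by algebra
    finally show "pd2 P (r, \<theta>) = N (r, \<theta>) - ?q r * pd2 V (r, \<theta>)" .
    have "pd2 N (r, \<theta>) = pd2 Q2 (r, \<theta>) * cos \<theta> - pd2 Q1 (r, \<theta>) * sin \<theta> - P (r, \<theta>)"
      unfolding P_def N_def by (rule pd2_eqI) (auto intro!: derivative_eq_intros D2)
    also have "\<dots> = r * ?q r ^ 3 * W (r, \<theta>) - P (r, \<theta>)"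
      using e sc by algebra
    finally show "pd2 N (r, \<theta>) = r * ?q r ^ 3 * W (r, \<theta>) - P (r, \<theta>)" .
  qed
  \<comment> \<open>In the derivatives of \<open>h\<close> the terms with derivatives of
    \<open>V\<close> cancel. The formula for \<open>pd1 A\<close> uses \<open>Vr\<close> and so
    holds on the sonic line too.\<close>
  have pd_h: "pd1 h (r, \<theta>) = (?c r)\<^sup>2 / (?q r)\<^sup>2 * A (r, \<theta>)" "pd2 h (r, \<theta>) = B (r, \<theta>)"
    and pdA: "pd1 A (r, \<theta>) = - W (r, \<theta>) * ((?c r)\<^sup>2 - (?q r)\<^sup>2) / r - P (r, \<theta>) * ((?q r)\<^sup>2 - (?c r)\<^sup>2) / (r\<^sup>2 * ?q r ^ 3)"
    and pdB: "pd2 B (r, \<theta>) = r * (?q r)\<^sup>2 * W (r, \<theta>) - P (r, \<theta>) / ?q r"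
    if r: "r \<in> {0<..<1}" for r \<theta>
  proof -
    have pos: "r > 0" "?q r > 0" using r q by auto
    note Dq = DERIV_q_of[OF g r]
    note D1 = DERIV_pd1[OF D[OF V r]] DERIV_pd1[OF D[OF smooth(1) r]] Dq
    note D2 = DERIV_pd2[OF D[OF V r]] DERIV_pd2[OF D[OF smooth(1) r]] DERIV_pd2[OF D[OF smooth(2) r]]
    show "pd1 h (r, \<theta>) = (?c r)\<^sup>2 / (?q r)\<^sup>2 * A (r, \<theta>)"
      unfolding h_def A_def using pos
      by (intro pd1_eqI) (auto intro!: derivative_eq_intros D1 simp: pdP[OF r] field_simps power2_eq_square)
    show "pd2 h (r, \<theta>) = B (r, \<theta>)"
      unfolding h_def B_def using pos
      by (intro pd2_eqI) (auto intro!: derivative_eq_intros D2 simp: pdP[OF r] field_simps power2_eq_square)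
    show "pd1 A (r, \<theta>) = - W (r, \<theta>) * ((?c r)\<^sup>2 - (?q r)\<^sup>2) / r - P (r, \<theta>) * ((?q r)\<^sup>2 - (?c r)\<^sup>2) / (r\<^sup>2 * ?q r ^ 3)"
      unfolding A_def using pos
      by (intro pd1_eqI) (auto intro!: derivative_eq_intros D1 simp: pdP[OF r] Vr[OF r] field_simps power2_eq_square power3_eq_cube)
    show "pd2 B (r, \<theta>) = r * (?q r)\<^sup>2 * W (r, \<theta>) - P (r, \<theta>) / ?q r"
      unfolding B_def using pos
      by (intro pd2_eqI) (auto intro!: derivative_eq_intros D2 simp: pdN[OF r] field_simps power2_eq_square power3_eq_cube)
  qed

  \<comment> \<open>Transport of the generator to the variables \<mu> and \<theta>\<close>
  obtain \<rho> where oT: "open ?T" and inv: "\<And>r. r \<in> {0<..<1} \<Longrightarrow> \<rho> (\<mu> r) = r"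
    and D\<rho>: "\<And>r. r \<in> {0<..<1} \<Longrightarrow> (\<rho> has_real_derivative (?q r)\<^sup>2 / (?c r)\<^sup>2) (at (\<mu> r))"
    using mu_function_inverse[OF g \<mu>] by blast
  have T: "\<exists>r\<in>{0<..<1}. fst p = \<mu> r" if "p \<in> ?T" for p
    using that by (auto simp: mu_theta_domain_def)
  have memT: "(\<mu> r, \<theta>) \<in> ?T" if "r \<in> {0<..<1}" for r \<theta>
    using that by (auto simp: mu_theta_domain_def)
  define H where "H = (\<lambda>p. h (\<rho> (fst p), snd p))"
  have "smooth_on ?T H"
    unfolding H_def
  \<comment> \<open>The derivative of \<open>\<rho>\<close> is known only in terms of
    \<open>\<rho>\<close> itself, so its smoothness has to be bootstrapped.\<close>
  proof (rule smooth_on_autonomous_reparam[where \<psi> = "\<lambda>p. (?q (fst p))\<^sup>2 / (?c (fst p))\<^sup>2", OF oD oT _ _ _ smooth(5)])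
    show "(\<rho> (fst p), snd p) \<in> ?D" if "p \<in> ?T" for p
      using T[OF that] inv by auto
    show "(\<rho> has_real_derivative (?q (fst (\<rho> (fst p), snd p)))\<^sup>2 / (?c (fst (\<rho> (fst p), snd p)))\<^sup>2) (at (fst p))"
      if "p \<in> ?T" for p
      using T[OF that] inv D\<rho> by auto
    show "smooth_on ?D (\<lambda>p. (?q (fst p))\<^sup>2 / (?c (fst p))\<^sup>2)"
      using c by (intro smooth_on_divide smooth_on_power smooth_on_q_of smooth_on_c_of_sq oD g)
        (auto simp: rho_theta_domain_def less_imp_neq[symmetric])
  qed
  have reparam: "((\<lambda>p. f (\<rho> (fst p), snd p)) has_derivative (\<lambda>v. fst v * ((?q r)\<^sup>2 / (?c r)\<^sup>2 * pd1 f (r, \<theta>))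
        + snd v * pd2 f (r, \<theta>))) (at (\<mu> r, \<theta>))"
    if "smooth_on ?D f" "r \<in> {0<..<1}" for f :: "real \<times> real \<Rightarrow> real" and r \<theta>
    using has_derivative_reparam[where p = "(\<mu> r, \<theta>)" and f = f, of \<rho>] D\<rho>[OF that(2)] D[OF that] inv[OF that(2)]
    by (simp del: times_divide_eq_left)
  \<comment> \<open>The factor \<open>q^2 / c^2\<close> from \<open>\<rho>\<close> cancels the
    factor \<open>c^2 / q^2\<close> in \<open>pd1 h\<close>.\<close>
  have pdH: "pd1 H (\<mu> r, \<theta>) = A (r, \<theta>)" "pd2 H (\<mu> r, \<theta>) = B (r, \<theta>)" if r: "r \<in> {0<..<1}" for r \<theta>
    using pd_unique[OF reparam[OF smooth(5) r]] q[OF r] c[OF r] unfolding H_def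
    by (auto simp: pd_h[OF r])
  have "pd1 (pd1 H) (\<mu> r, \<theta>) + 1 / r\<^sup>2 * (1 - (mach g r)\<^sup>2) * pd2 (pd2 H) (\<mu> r, \<theta>) = 0" if r: "r \<in> {0<..<1}" for r \<theta>
  proof -
    \<comment> \<open>The first derivatives of \<open>H\<close> are identified on the whole open
      domain, so that they can be differentiated once more.\<close>
    have A: "A (\<rho> (fst p), snd p) = pd1 H p" and B: "B (\<rho> (fst p), snd p) = pd2 H p" if "p \<in> ?T" for p
      using T[OF that] pdH inv by (metis prod.collapse)+
    have H11: "pd1 (pd1 H) (\<mu> r, \<theta>) = (?q r)\<^sup>2 / (?c r)\<^sup>2 * pd1 A (r, \<theta>)"
      by (rule pd_unique(1)[OF has_derivative_transform_within_open[OF reparam[OF smooth(3) r] oT memT[OF r] A]])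
    have H22: "pd2 (pd2 H) (\<mu> r, \<theta>) = pd2 B (r, \<theta>)"
      by (rule pd_unique(2)[OF has_derivative_transform_within_open[OF reparam[OF smooth(4) r] oT memT[OF r] B]])
    \<comment> \<open>With \<open>1 - M^2 = (c^2 - q^2) / c^2\<close>, the \<open>W\<close> terms
      and the \<open>P\<close> terms cancel separately.\<close>
    show ?thesis
      unfolding H11 H22 pdA[OF r] pdB[OF r] mach_def
      using r q[OF r] c[OF r] by (simp add: field_simps power2_eq_square power3_eq_cube)
  qed
  with \<open>smooth_on ?T H\<close> have "tricomi_solution g \<mu> H"
    by (simp add: tricomi_solution_def)
  moreover have "loewner_morawetz g \<mu> H Q1 Q2"
    unfolding loewner_morawetz_def Let_def
  proof (intro ballI allI)
    fix r \<theta> :: real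
    assume r: "r \<in> {0<..<1}"
    have sc: "(cos \<theta>)\<^sup>2 = 1 - (sin \<theta>)\<^sup>2"
      by (simp add: cos_squared_eq)
    have "r * ?q r * A (r, \<theta>) = Q1 (r, \<theta>) * cos \<theta> + Q2 (r, \<theta>) * sin \<theta>"
      "?q r * B (r, \<theta>) = Q2 (r, \<theta>) * cos \<theta> - Q1 (r, \<theta>) * sin \<theta>"
      using r q[OF r] by (auto simp: A_def B_def P_def N_def)
    then show "Q1 (r, \<theta>) = r * ?q r * pd1 H (\<mu> r, \<theta>) * cos \<theta> - ?q r * pd2 H (\<mu> r, \<theta>) * sin \<theta> \<and>
        Q2 (r, \<theta>) = r * ?q r * pd1 H (\<mu> r, \<theta>) * sin \<theta> + ?q r * pd2 H (\<mu> r, \<theta>) * cos \<theta>"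
      unfolding pdH[OF r] using sc by algebra
  qed
  ultimately show ?thesis by blast
qed

text \<open>Both \<open>V\<close> and \<open>W\<close> are written down from \<open>H\<close>. The
  only denominators in \<open>W\<close> are \<open>\<rho>\<close> and \<open>q^2\<close>, so it is
  smooth across the sonic line; the Tricomi equation identifies it with the required quotient
  elsewhere.\<close>

lemma generator_imp_entropy_pair:
  assumes g: "g \<ge> 1" and \<mu>: "mu_function g \<mu>"
    and Q1: "smooth_on rho_theta_domain Q1" and Q2: "smooth_on rho_theta_domain Q2"
    and H: "tricomi_solution g \<mu> H" and LM: "loewner_morawetz g \<mu> H Q1 Q2"
  shows "entropy_pair g Q1 Q2"
proof -
  let ?D = rho_theta_domain and ?T = "mu_theta_domain \<mu>"
  let ?q = "q_of g" and ?c = "c_of g"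
  note oD = open_rho_theta_domain
  have q: "?q r > 0" and c: "?c r > 0" if "r \<in> {0<..<1}" for r
    using q_of_pos[OF g that] c_of_pos_square(1)[OF g that] by auto
  have sH: "smooth_on ?T H"
    using H by (simp add: tricomi_solution_def)
  have oT: "open ?T"
    using mu_function_inverse[OF g \<mu>] by blast
  note sHs = smooth_on_pd[OF oT sH]
  have memT: "(\<mu> r, \<theta>) \<in> ?T" if "r \<in> {0<..<1}" for r \<theta>
    using that by (auto simp: mu_theta_domain_def)
  have D\<mu>: "(\<mu> has_real_derivative (?c (fst p))\<^sup>2 / (?q (fst p))\<^sup>2) (at (fst p))" if "p \<in> ?D" for p
    using \<mu> that by (auto simp: mu_function_def rho_theta_domain_def)
  \<comment> \<open>Here the derivative of \<open>\<mu>\<close> is an explicit smooth function of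
    the density, so the direct chain rule induction applies.\<close>
  have comp_smooth: "smooth_on ?D (\<lambda>p. f (\<mu> (fst p), snd p))" if "smooth_on ?T f" for f :: "real \<times> real \<Rightarrow> real"
  proof (rule smooth_on_reparam[OF oT oD _ D\<mu> _ that])
    show "smooth_on ?D (\<lambda>p. (?c (fst p))\<^sup>2 / (?q (fst p))\<^sup>2)"
      using q by (intro smooth_on_divide smooth_on_power smooth_on_q_of smooth_on_c_of_sq oD g)
        (auto simp: rho_theta_domain_def less_imp_neq[symmetric])
  qed (auto simp: mu_theta_domain_def rho_theta_domain_def)
  define h where "h = (\<lambda>p. H (\<mu> (fst p), snd p))"
  define A where "A = (\<lambda>p. pd1 H (\<mu> (fst p), snd p))"
  define B where "B = (\<lambda>p. pd2 H (\<mu> (fst p), snd p))"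
  have smooth: "smooth_on ?D h" "smooth_on ?D A" "smooth_on ?D B"
    unfolding h_def A_def B_def by (intro comp_smooth sH sHs)+
  \<comment> \<open>This choice gives \<open>V\<^sub>\<theta> = H\<^sub>\<theta> - \<rho>
    H\<^sub>\<mu>\<^sub>\<theta>\<close>, and \<open>W\<close> is obtained by solving
    \<open>H\<^sub>\<mu> + H\<^sub>\<theta>\<^sub>\<theta> / \<rho> = q^2 W\<close>.\<close>
  define V where "V = (\<lambda>p. h p - fst p * A p)"
  define W where "W = (\<lambda>p. (A p + pd2 B p / fst p) / (?q (fst p))\<^sup>2)"
  have V: "smooth_on ?D V"
    unfolding V_def by (intro smooth_on_diff smooth_on_mult smooth_on_fst oD smooth)
  have nz: "fst p \<noteq> 0" "?q (fst p) \<noteq> 0" if "p \<in> ?D" for p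
    using that q[of "fst p"] by (auto simp: rho_theta_domain_def)
  have W: "smooth_on ?D W"
    unfolding W_def
    using nz by (intro smooth_on_add smooth_on_divide smooth_on_power smooth_on_q_of smooth_on_fst
        smooth_on_pd oD smooth g) simp_all
  have pd_comp: "pd1 (\<lambda>p. f (\<mu> (fst p), snd p)) (r, \<theta>) = (?c r)\<^sup>2 / (?q r)\<^sup>2 * pd1 f (\<mu> r, \<theta>)"
    "pd2 (\<lambda>p. f (\<mu> (fst p), snd p)) (r, \<theta>) = pd2 f (\<mu> r, \<theta>)"
    if "smooth_on ?T f" "r \<in> {0<..<1}" for f r \<theta>
    using pd_unique[OF has_derivative_reparam[where p = "(r, \<theta>)" and f = f and \<phi> = \<mu>]]
      D\<mu>[of "(r, \<theta>)"] smooth_on_imp_differentiable[OF that(1) memT[OF that(2)]] that(2)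
    by auto
  have D: "f differentiable (at (r, \<theta>))" if "smooth_on ?D f" "r \<in> {0<..<1}" for f :: "real \<times> real \<Rightarrow> real" and r \<theta>
    using that by (intro smooth_on_imp_differentiable[of ?D]) auto
  have main: "(?q r \<noteq> ?c r \<longrightarrow> W (r, \<theta>) = pd1 V (r, \<theta>) / ((?c r)\<^sup>2 - (?q r)\<^sup>2)) \<and>
      pd1 Q1 (r, \<theta>) = (?c r)\<^sup>2 / (r * ?q r) * sin \<theta> * pd2 V (r, \<theta>) - ?q r * cos \<theta> * pd1 V (r, \<theta>) \<and>
      pd2 Q1 (r, \<theta>) = - ?q r * cos \<theta> * pd2 V (r, \<theta>) - r * ?q r ^ 3 * sin \<theta> * W (r, \<theta>) \<and>
      pd1 Q2 (r, \<theta>) = - ((?c r)\<^sup>2 / (r * ?q r)) * cos \<theta> * pd2 V (r, \<theta>) - ?q r * sin \<theta> * pd1 V (r, \<theta>) \<and>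
      pd2 Q2 (r, \<theta>) = - ?q r * sin \<theta> * pd2 V (r, \<theta>) + r * ?q r ^ 3 * cos \<theta> * W (r, \<theta>)"
    if r: "r \<in> {0<..<1}" for r \<theta>
  proof -
    have pos: "r > 0" "?q r > 0" "?c r > 0" using r q c by auto
    define k where "k = (?c r)\<^sup>2 / (?q r)\<^sup>2"
    have pdh: "pd1 h (r, \<theta>) = k * A (r, \<theta>)" "pd2 h (r, \<theta>) = B (r, \<theta>)"
      using pd_comp[OF sH r] by (auto simp: h_def A_def B_def k_def)
    have A1: "pd1 A (r, \<theta>) = k * pd1 (pd1 H) (\<mu> r, \<theta>)"
      using pd_comp[OF sHs(1) r] by (simp add: A_def k_def)
    have B2: "pd2 B (r, \<theta>) = pd2 (pd2 H) (\<mu> r, \<theta>)"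
      using pd_comp[OF sHs(2) r] by (simp add: B_def)
    \<comment> \<open>Equality of the mixed derivatives of \<open>H\<close> links
      \<open>pd1 B\<close> with \<open>pd2 A\<close>; \<open>k\<close> is the factor from the change
      of variable.\<close>
    have B1: "pd1 B (r, \<theta>) = k * pd2 A (r, \<theta>)"
      using pd_comp[OF sHs(1) r] pd_comp[OF sHs(2) r] pd1_pd2_commute[OF oT sH memT[OF r]]
      by (simp add: A_def B_def k_def)
    have tric: "pd1 (pd1 H) (\<mu> r, \<theta>) = - (1 / r\<^sup>2 * (1 - (mach g r)\<^sup>2) * pd2 B (r, \<theta>))"
      using H r B2 unfolding tricomi_solution_def by (metis eq_neg_iff_add_eq_0)
    note D1 = DERIV_pd1[OF D[OF smooth(1) r]] DERIV_pd1[OF D[OF smooth(2) r]] DERIV_pd1[OF D[OF smooth(3) r]]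
      DERIV_q_of[OF g r]
    note D2 = DERIV_pd2[OF D[OF smooth(1) r]] DERIV_pd2[OF D[OF smooth(2) r]] DERIV_pd2[OF D[OF smooth(3) r]]
    have V2: "pd2 V (r, \<theta>) = B (r, \<theta>) - r * pd2 A (r, \<theta>)"
      unfolding V_def by (rule pd2_eqI) (auto intro!: derivative_eq_intros D2 simp: pdh)
    have V1': "pd1 V (r, \<theta>) = k * A (r, \<theta>) - A (r, \<theta>) - r * pd1 A (r, \<theta>)"
      unfolding V_def by (rule pd1_eqI) (auto intro!: derivative_eq_intros D1 simp: pdh)
    \<comment> \<open>The Tricomi equation enters here: once it has replaced
      \<open>H\<^sub>\<mu>\<^sub>\<mu>\<close>, the \<open>A\<close> and the \<open>B\<close> terms
      share the factor \<open>(c^2 - q^2) / q^2\<close>.\<close>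
    have "k * A (r, \<theta>) - A (r, \<theta>) - r * pd1 A (r, \<theta>) = ((?c r)\<^sup>2 - (?q r)\<^sup>2) * W (r, \<theta>)"
      using pos unfolding A1 tric W_def mach_def k_def by (simp add: divide_simps) algebra
    with V1' have V1: "pd1 V (r, \<theta>) = ((?c r)\<^sup>2 - (?q r)\<^sup>2) * W (r, \<theta>)"
      by simp
    \<comment> \<open>The pair agrees with \<open>F1\<close> and \<open>F2\<close> on the domain;
      since this is open, their partial derivatives agree there as well.\<close>
    define F1 where "F1 = (\<lambda>p. fst p * ?q (fst p) * A p * cos (snd p) - ?q (fst p) * B p * sin (snd p))"
    define F2 where "F2 = (\<lambda>p. fst p * ?q (fst p) * A p * sin (snd p) + ?q (fst p) * B p * cos (snd p))"
    have QF: "Q1 x = F1 x" "Q2 x = F2 x" if "x \<in> ?D" for x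
      using LM that unfolding loewner_morawetz_def Let_def
      by (auto simp: F1_def F2_def A_def B_def rho_theta_domain_def)
    have mem: "(r, \<theta>) \<in> ?D" using r by simp
    have FQ: "pd1 Q1 (r, \<theta>) = pd1 F1 (r, \<theta>)" "pd2 Q1 (r, \<theta>) = pd2 F1 (r, \<theta>)"
      "pd1 Q2 (r, \<theta>) = pd1 F2 (r, \<theta>)" "pd2 Q2 (r, \<theta>) = pd2 F2 (r, \<theta>)"
      using pd_cong[OF oD mem QF(1) D[OF Q1 r]] pd_cong[OF oD mem QF(2) D[OF Q2 r]] by auto
    \<comment> \<open>\<open>P1\<close> and \<open>N1\<close> are the
      \<open>\<rho>\<close>-derivatives of the rotated components
      \<open>\<rho> q H\<^sub>\<mu>\<close> and \<open>q H\<^sub>\<theta>\<close>, with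
      \<open>q'\<close> inserted.\<close>
    define P1 where "P1 = ?q r * A (r, \<theta>) - (?c r)\<^sup>2 / ?q r * A (r, \<theta>) + r * ?q r * pd1 A (r, \<theta>)"
    define N1 where "N1 = - (?c r)\<^sup>2 / (r * ?q r) * B (r, \<theta>) + ?q r * pd1 B (r, \<theta>)"
    have P1: "P1 = - ?q r * pd1 V (r, \<theta>)"
      unfolding P1_def V1' k_def using pos by (simp add: field_simps power2_eq_square)
    have N1: "N1 = - ((?c r)\<^sup>2 / (r * ?q r)) * pd2 V (r, \<theta>)"
      unfolding N1_def V2 B1 k_def using pos by (simp add: field_simps power2_eq_square)
    have W': "r * ?q r ^ 3 * W (r, \<theta>) = r * ?q r * A (r, \<theta>) + ?q r * pd2 B (r, \<theta>)"
      unfolding W_def using pos by (simp add: field_simps power2_eq_square power3_eq_cube)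
    have "pd1 F1 (r, \<theta>) = P1 * cos \<theta> - N1 * sin \<theta>" "pd1 F2 (r, \<theta>) = P1 * sin \<theta> + N1 * cos \<theta>"
      unfolding F1_def F2_def P1_def N1_def using pos
      by (intro pd1_eqI; auto intro!: derivative_eq_intros D1 simp: field_simps)+
    moreover have "pd2 F1 (r, \<theta>) = (r * ?q r * pd2 A (r, \<theta>) - ?q r * B (r, \<theta>)) * cos \<theta>
        - (r * ?q r * A (r, \<theta>) + ?q r * pd2 B (r, \<theta>)) * sin \<theta>"
      "pd2 F2 (r, \<theta>) = (r * ?q r * pd2 A (r, \<theta>) - ?q r * B (r, \<theta>)) * sin \<theta>
        + (r * ?q r * A (r, \<theta>) + ?q r * pd2 B (r, \<theta>)) * cos \<theta>"
      unfolding F1_def F2_def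
      by (intro pd2_eqI; auto intro!: derivative_eq_intros D2 simp: field_simps)+
    moreover have "W (r, \<theta>) = pd1 V (r, \<theta>) / ((?c r)\<^sup>2 - (?q r)\<^sup>2)" if "?q r \<noteq> ?c r"
    proof -
      have "(?c r)\<^sup>2 - (?q r)\<^sup>2 \<noteq> 0"
        using that pos by (auto simp: power2_eq_iff_nonneg)
      then show ?thesis unfolding V1 by simp
    qed
    ultimately show ?thesis
      unfolding FQ P1 N1 W'[symmetric] V2 by (auto simp: algebra_simps)
  qed
  show ?thesis
    unfolding entropy_pair_def Let_def using Q1 Q2 V W main by blast
qed

theorem lemma7p1:
  fixes g :: real and \<mu> :: "real \<Rightarrow> real" and Q1 Q2 :: "real \<times> real \<Rightarrow> real"
  assumes "g \<ge> 1"
    and "mu_function g \<mu>"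
    and "smooth_on rho_theta_domain Q1"
    and "smooth_on rho_theta_domain Q2"
  shows "entropy_pair g Q1 Q2 \<longleftrightarrow>
           (\<exists>H. tricomi_solution g \<mu> H \<and> loewner_morawetz g \<mu> H Q1 Q2)"
  using entropy_pair_imp_ex_generator[OF assms(1,2)] generator_imp_entropy_pair[OF assms] by blast

end
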